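(* Let $(S_1,\circ)$ and $(S_2,\bullet)$ be partial semigroups. If $(Q,\le,\circ,\bullet)$ is a bi-quantale (respectively a distributive bi-quantale), then so is $(Q^{S_1\times S_2},\le,\circ,\bullet)$. It is unital whenever $Q$ is unital and $S_1$ and $S_2$ are partial monoids. The convolution $\circ$ (respectively $\bullet$) on $Q^{S_1\times S_2}$ is commutative if the operation $\circ$ on $S_1$ and on $Q$ (respectively $\bullet$ on $S_2$ and on $Q$) is commutative.
   Context: A partial semigroup has an associative partial operation (undefined products denoted $\bot$, not an element); a partial monoid additionally has a unit. A bi-quantale $(Q,\le,\circ,\bullet)$ is a complete lattice with two multiplications such that $(Q,\le,\circ)$ and $(Q,\le,\bullet)$ are quantales (associative multiplication distributing over arbitrary suprema on both sides); distributive if binary meets distribute over arbitrary joins and binary joins over arbitrary meets; unital if both multiplications have units $1_\circ$, $1_\bullet$ (possibly different). On $Q^{S_1\times S_2}$ (curried, $F\,x\,y$): order, suprema, infima pointwise; $(F\circ G)\,x\,y=\sum_{x=x_1\circ x_2}F\,x_1\,y\circ G\,x_2\,y$ and $(F\bullet G)\,x\,y=\sum_{y=y_1\bullet y_2}F\,x\,y_1\bullet G\,x\,y_2$ (sums over decompositions with defined products); units $\mathbb{1}_\circ\,x\,y=1_\circ$ if $x=1_\circ$ and $0$ otherwise, $\mathbb{1}_\bullet\,x\,y=1_\bullet$ if $y=1_\bullet$ and $0$ otherwise. *)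

theory Defs
  imports Main
begin

text \<open>
  Partial operations are maps into \<^typ>\<open>'a option\<close>, with \<^const>\<open>None\<close> in the role of the
  undefined value \<open>\<bottom>\<close>. Associativity is Kleene equality: either both bracketings are undefined,
  or both are defined and equal.
\<close>

locale partial_semigroup =
  fixes pmult :: "'a \<Rightarrow> 'a \<Rightarrow> 'a option"
  assumes passoc:
    "Option.bind (pmult x y) (\<lambda>u. pmult u z) = Option.bind (pmult y z) (\<lambda>v. pmult x v)"

locale partial_monoid = partial_semigroup pmult
  for pmult :: "'a \<Rightarrow> 'a \<Rightarrow> 'a option" +
  fixes punit :: 'a
  assumes punit_left: "pmult punit x = Some x"
    and punit_right: "pmult x punit = Some x"

text \<open>
  The suprema range over all subsets, including the empty one, so multiplication is strict
  with respect to \<^term>\<open>bot\<close> on both sides.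
\<close>

locale quantale = semigroup mult
  for mult :: "'q::complete_lattice \<Rightarrow> 'q \<Rightarrow> 'q" +
  assumes Sup_mult: "mult (Sup A) y = (SUP x\<in>A. mult x y)"
    and mult_Sup: "mult x (Sup A) = (SUP y\<in>A. mult x y)"

locale bi_quantale =
  circ: quantale circ + bullet: quantale bullet
  for circ bullet :: "'q::complete_lattice \<Rightarrow> 'q \<Rightarrow> 'q"

text \<open>
  These are the two infinite distributive laws only; the library class
  \<^class>\<open>complete_distrib_lattice\<close> demands complete distributivity, which is stronger.
\<close>

locale distributive_bi_quantale = bi_quantale circ bullet
  for circ bullet :: "'q::complete_lattice \<Rightarrow> 'q \<Rightarrow> 'q" +
  assumes inf_Sup_distrib: "inf x (Sup A) = (SUP a\<in>(A :: 'q set). inf x a)"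
    and sup_Inf_distrib: "sup x (Inf A) = (INF a\<in>(A :: 'q set). sup x a)"

locale unital_bi_quantale =
  bi_quantale circ bullet + circ: monoid circ one_circ + bullet: monoid bullet one_bullet
  for circ bullet :: "'q::complete_lattice \<Rightarrow> 'q \<Rightarrow> 'q" and one_circ one_bullet :: 'q

definition commutative_op :: "('a \<Rightarrow> 'a \<Rightarrow> 'b) \<Rightarrow> bool" where
  "commutative_op f \<longleftrightarrow> (\<forall>x y. f x y = f y x)"

text \<open>
  Convolution in one argument, the other being fixed. The functions \<open>S\<^sub>1 \<times> S\<^sub>2 \<rightarrow> Q\<close> are curried;
  their order, suprema and infima are the pointwise ones of the library's function-space instances.
\<close>

definition conv_circ ::
  "('a \<Rightarrow> 'a \<Rightarrow> 'a option) \<Rightarrow> ('q::complete_lattice \<Rightarrow> 'q \<Rightarrow> 'q)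
    \<Rightarrow> ('a \<Rightarrow> 'b \<Rightarrow> 'q) \<Rightarrow> ('a \<Rightarrow> 'b \<Rightarrow> 'q) \<Rightarrow> 'a \<Rightarrow> 'b \<Rightarrow> 'q" where
  "conv_circ pcirc circ F G =
    (\<lambda>x y. Sup {circ (F x1 y) (G x2 y) | x1 x2. pcirc x1 x2 = Some x})"

definition conv_bullet ::
  "('b \<Rightarrow> 'b \<Rightarrow> 'b option) \<Rightarrow> ('q::complete_lattice \<Rightarrow> 'q \<Rightarrow> 'q)
    \<Rightarrow> ('a \<Rightarrow> 'b \<Rightarrow> 'q) \<Rightarrow> ('a \<Rightarrow> 'b \<Rightarrow> 'q) \<Rightarrow> 'a \<Rightarrow> 'b \<Rightarrow> 'q" where
  "conv_bullet pbullet bullet F G =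
    (\<lambda>x y. Sup {bullet (F x y1) (G x y2) | y1 y2. pbullet y1 y2 = Some y})"

definition unit_circ :: "'a \<Rightarrow> 'q::complete_lattice \<Rightarrow> 'a \<Rightarrow> 'b \<Rightarrow> 'q" where
  "unit_circ e one_circ = (\<lambda>x y. if x = e then one_circ else bot)"

definition unit_bullet :: "'b \<Rightarrow> 'q::complete_lattice \<Rightarrow> 'a \<Rightarrow> 'b \<Rightarrow> 'q" where
  "unit_bullet e one_bullet = (\<lambda>x y. if y = e then one_bullet else bot)"

end

theory Submission
  imports Defs
begin

text \<open>
  The two multiplications do not interact, and each is obtained from one convolution in a single
  variable and the pointwise lifting to a function space, both of which preserve quantales, units
  and commutativity: \<open>\<bullet>\<close> on \<open>Q\<^bsup>S\<^sub>1\<times>S\<^sub>2\<^esup>\<close> is the lifting to \<open>S\<^sub>1\<close> of the convolution over \<open>S\<^sub>2\<close>, while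
  \<open>\<circ>\<close> is the convolution over \<open>S\<^sub>1\<close> with values in the lifting of \<open>Q\<close> to \<open>S\<^sub>2\<close>.
\<close>

definition lift_op :: "('q \<Rightarrow> 'q \<Rightarrow> 'q) \<Rightarrow> ('a \<Rightarrow> 'q) \<Rightarrow> ('a \<Rightarrow> 'q) \<Rightarrow> 'a \<Rightarrow> 'q" where
  "lift_op m f g = (\<lambda>x. m (f x) (g x))"

definition conv ::
  "('a \<Rightarrow> 'a \<Rightarrow> 'a option) \<Rightarrow> ('q::complete_lattice \<Rightarrow> 'q \<Rightarrow> 'q) \<Rightarrow> ('a \<Rightarrow> 'q) \<Rightarrow> ('a \<Rightarrow> 'q) \<Rightarrow> 'a \<Rightarrow> 'q"
  where "conv p m f g = (\<lambda>x. Sup {m (f x1) (g x2) | x1 x2. p x1 x2 = Some x})"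

text \<open>The Kronecker delta at \<open>e\<close> with value \<open>i\<close>; \<open>bot\<close>,
  the empty supremum, takes the place of zero.\<close>

definition conv_unit :: "'a \<Rightarrow> 'q::complete_lattice \<Rightarrow> 'a \<Rightarrow> 'q" where
  "conv_unit e i = (\<lambda>x. if x = e then i else bot)"

text \<open>Suprema of functions are pointwise, so evaluation at \<open>y\<close> commutes with the
  supremum over decompositions of \<open>x\<close>. This moves the second variable into the value
  quantale.\<close>

lemma conv_circ_eq: "conv_circ p m = conv p (lift_op m)"
proof (intro ext)
  fix F G x y
  have "{m (F x1 y) (G x2 y) | x1 x2. p x1 x2 = Some x}
      = (\<lambda>h. h y) ` {lift_op m (F x1) (G x2) | x1 x2. p x1 x2 = Some x}"
    unfolding lift_op_def by (auto intro!: rev_image_eqI)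
  then show "conv_circ p m F G x y = conv p (lift_op m) F G x y"
    by (simp add: conv_circ_def conv_def)
qed

lemma conv_bullet_eq: "conv_bullet p m = lift_op (conv p m)"
  by (simp add: fun_eq_iff conv_bullet_def lift_op_def conv_def)

text \<open>The \<open>bot\<close> inside \<open>conv_unit\<close> is here a function of the second
  variable, constantly \<open>bot\<close>.\<close>

lemma unit_circ_eq: "unit_circ e i = conv_unit e (\<lambda>_. i)"
  by (auto simp: fun_eq_iff unit_circ_def conv_unit_def)

lemma unit_bullet_eq: "unit_bullet e i = (\<lambda>_. conv_unit e i)"
  by (auto simp: fun_eq_iff unit_bullet_def conv_unit_def)

lemma quantale_lift_op:
  assumes "quantale m"
  shows "quantale (lift_op m)"
proof -
  interpret quantale m by fact
  show ?thesis
    by unfold_locales (simp_all add: lift_op_def fun_eq_iff assoc Sup_mult mult_Sup image_image)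
qed

lemma monoid_lift_op:
  assumes "monoid m i"
  shows "monoid (lift_op m) (\<lambda>_. i)"
proof -
  interpret monoid m i by fact
  show ?thesis
    by unfold_locales (simp_all add: lift_op_def assoc)
qed

lemma commutative_lift_op: "commutative_op m \<Longrightarrow> commutative_op (lift_op m)"
  by (simp add: commutative_op_def lift_op_def)

text \<open>With \<open>conv_least\<close>, this is the universal property of the supremum in
  \<open>conv\<close>; inequalities between convolutions reduce to single decompositions.\<close>

lemma conv_upper: "p a b = Some x \<Longrightarrow> m (f a) (g b) \<le> conv p m f g x"
  by (auto simp: conv_def intro: Sup_upper)

lemma conv_least:
  "(\<And>a b. p a b = Some x \<Longrightarrow> m (f a) (g b) \<le> c) \<Longrightarrow> conv p m f g x \<le> c"
  by (auto simp: conv_def intro: Sup_least)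

context quantale
begin

text \<open>If \<open>x \<le> x'\<close> then \<open>x'\<close> is the supremum of the pair, so
  distributivity over two-element sets yields monotonicity in each argument.\<close>

lemma mult_mono: "x \<le> x' \<Longrightarrow> y \<le> y' \<Longrightarrow> mult x y \<le> mult x' y'"
proof -
  assume le: "x \<le> x'" "y \<le> y'"
  have "mult x' y = sup (mult x y) (mult x' y)"
    using Sup_mult[of "{x, x'}" y] le by (simp add: sup_absorb2)
  moreover have "mult x' y' = sup (mult x' y) (mult x' y')"
    using mult_Sup[of x' "{y, y'}"] le by (simp add: sup_absorb2)
  ultimately show ?thesis
    by (metis sup_ge1 order_trans)
qed

text \<open>Distributivity over the empty supremum; it makes the summands of a convolution with
  \<open>conv_unit\<close> vanish away from \<open>e\<close>.\<close>

lemma mult_bot_left: "mult bot x = bot" and mult_bot_right: "mult x bot = bot"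
  using Sup_mult[of "{}" x] mult_Sup[of x "{}"] by simp_all

text \<open>Multiplication distributes over the inner supremum, so a nested convolution is bounded
  by testing products of three values.\<close>

lemma conv_mult_le:
  assumes "\<And>a b. p a b = Some x \<Longrightarrow> mult (mult (f a) (g b)) z \<le> c"
  shows "mult (conv p mult f g x) z \<le> c"
  unfolding conv_def Sup_mult using assms by (auto intro!: Sup_least)

lemma mult_conv_le:
  assumes "\<And>a b. p a b = Some x \<Longrightarrow> mult z (mult (f a) (g b)) \<le> c"
  shows "mult z (conv p mult f g x) \<le> c"
  unfolding conv_def mult_Sup using assms by (auto intro!: Sup_least)

text \<open>Both sides are suprema over decompositions of \<open>x\<close> into three factors.
  Rebracketing the factors by \<open>passoc\<close> and the values by \<open>assoc\<close> turns
  each summand of one side into a summand of the other.\<close>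

lemma conv_assoc:
  assumes "partial_semigroup p"
  shows "conv p mult (conv p mult f g) h = conv p mult f (conv p mult g h)"
proof (intro ext antisym)
  interpret partial_semigroup p by fact
  fix x
  show "conv p mult (conv p mult f g) h x \<le> conv p mult f (conv p mult g h) x"
  proof (intro conv_least conv_mult_le)
    fix u a b c assume "p u c = Some x" "p a b = Some u"
    \<comment> \<open>Kleene equality carries definedness over to the other bracketing, which
      provides the intermediate product \<open>v\<close>.\<close>
    then have "Option.bind (p b c) (p a) = Some x"
      using passoc[of a b c] by simp
    then obtain v where v: "p b c = Some v" "p a v = Some x"
      by (auto simp: bind_eq_Some_conv)
    have "mult (f a) (mult (g b) (h c)) \<le> mult (f a) (conv p mult g h v)"
      by (intro mult_mono order_refl conv_upper v)
    also have "\<dots> \<le> conv p mult f (conv p mult g h) x"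
      by (intro conv_upper v)
    finally show "mult (mult (f a) (g b)) (h c) \<le> conv p mult f (conv p mult g h) x"
      by (simp add: assoc)
  qed
  show "conv p mult f (conv p mult g h) x \<le> conv p mult (conv p mult f g) h x"
  proof (intro conv_least mult_conv_le)
    fix a v b c assume "p a v = Some x" "p b c = Some v"
    then have "Option.bind (p a b) (\<lambda>u. p u c) = Some x"
      using passoc[of a b c] by simp
    then obtain u where u: "p a b = Some u" "p u c = Some x"
      by (auto simp: bind_eq_Some_conv)
    have "mult (mult (f a) (g b)) (h c) \<le> mult (conv p mult f g u) (h c)"
      by (intro mult_mono order_refl conv_upper u)
    also have "\<dots> \<le> conv p mult (conv p mult f g) h x"
      by (intro conv_upper u)
    finally show "mult (f a) (mult (g b) (h c)) \<le> conv p mult (conv p mult f g) h x"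
      by (simp add: assoc)
  qed
qed

text \<open>Each member of \<open>A\<close> lies below \<open>Sup A\<close>, so monotonicity gives
  the easy inequality in \<open>Sup_conv\<close> and \<open>conv_Sup\<close>.\<close>

lemma conv_mono:
  assumes "f \<le> f'" and "g \<le> g'"
  shows "conv p mult f g \<le> conv p mult f' g'"
proof (intro le_funI conv_least)
  fix x a b assume "p a b = Some x"
  then have "mult (f' a) (g' b) \<le> conv p mult f' g' x"
    by (rule conv_upper)
  then show "mult (f a) (g b) \<le> conv p mult f' g' x"
    using assms by (blast intro: order_trans mult_mono le_funD)
qed

lemma Sup_conv: "conv p mult (Sup A) g = (SUP f\<in>A. conv p mult f g)"
proof (rule antisym)
  show "conv p mult (Sup A) g \<le> (SUP f\<in>A. conv p mult f g)"
  proof (intro le_funI conv_least)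
    fix x a b assume "p a b = Some x"
    then show "mult ((Sup A) a) (g b) \<le> (SUP f\<in>A. conv p mult f g) x"
      \<comment> \<open>After distribution both sides are suprema over \<open>A\<close>; the term
        for each \<open>f\<close> is a summand of the convolution of that same \<open>f\<close> with
        \<open>g\<close>.\<close>
      by (auto simp: Sup_mult image_image intro!: SUP_mono conv_upper)
  qed
  show "(SUP f\<in>A. conv p mult f g) \<le> conv p mult (Sup A) g"
    by (intro SUP_least conv_mono Sup_upper order_refl)
qed

lemma conv_Sup: "conv p mult f (Sup A) = (SUP g\<in>A. conv p mult f g)"
proof (rule antisym)
  show "conv p mult f (Sup A) \<le> (SUP g\<in>A. conv p mult f g)"
  proof (intro le_funI conv_least)
    fix x a b assume "p a b = Some x"
    then show "mult (f a) ((Sup A) b) \<le> (SUP g\<in>A. conv p mult f g) x"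
      by (auto simp: mult_Sup image_image intro!: SUP_mono conv_upper)
  qed
  show "(SUP g\<in>A. conv p mult f g) \<le> conv p mult f (Sup A)"
    by (intro SUP_least conv_mono Sup_upper order_refl)
qed

lemma quantale_conv: "partial_semigroup p \<Longrightarrow> quantale (conv p mult)"
  by unfold_locales (simp_all only: conv_assoc Sup_conv conv_Sup)

text \<open>In a convolution with the delta on the left, a decomposition whose left factor is not
  \<open>e\<close> contributes \<open>bot\<close>, and a left factor \<open>e\<close> forces the
  right one to be \<open>x\<close>. The decomposition of \<open>x\<close> as \<open>e\<close> times
  \<open>x\<close> attains the value \<open>f x\<close>. The right unit law is symmetric.\<close>

lemma monoid_conv:
  assumes "partial_monoid p e" and "monoid mult i"
  shows "monoid (conv p mult) (conv_unit e i)"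
proof -
  interpret p: partial_monoid p e by fact
  interpret i: monoid mult i by fact
  show ?thesis
  proof
    fix f g h
    show "conv p mult (conv p mult f g) h = conv p mult f (conv p mult g h)"
      by (intro conv_assoc p.partial_semigroup_axioms)
    show "conv p mult (conv_unit e i) f = f"
    proof (intro ext antisym)
      fix x
      show "conv p mult (conv_unit e i) f x \<le> f x"
        by (rule conv_least) (auto simp: conv_unit_def mult_bot_left p.punit_left)
      show "f x \<le> conv p mult (conv_unit e i) f x"
        using conv_upper[of p e x x mult "conv_unit e i" f]
        by (simp add: conv_unit_def p.punit_left)
    qed
    show "conv p mult f (conv_unit e i) = f"
    proof (intro ext antisym)
      fix x
      show "conv p mult f (conv_unit e i) x \<le> f x"
        by (rule conv_least) (auto simp: conv_unit_def mult_bot_right p.punit_right)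
      show "f x \<le> conv p mult f (conv_unit e i) x"
        using conv_upper[of p x e x mult f "conv_unit e i"]
        by (simp add: conv_unit_def p.punit_right)
    qed
  qed
qed

end

text \<open>Swapping the two factors permutes the decompositions of \<open>x\<close>, and
  commutativity of \<open>m\<close> preserves each summand.\<close>

lemma commutative_conv:
  assumes "commutative_op p" and "commutative_op m"
  shows "commutative_op (conv p m)"
  unfolding commutative_op_def
proof (intro allI ext)
  fix f g x
  have p: "p a b = p b a" and m: "m s t = m t s" for a b s t
    using assms by (auto simp: commutative_op_def)
  have "{m (f a) (g b) | a b. p a b = Some x} = {m (g b) (f a) | b a. p b a = Some x}"
    by (subst p, subst m) blast
  then show "conv p m f g x = conv p m g f x"
    by (simp add: conv_def)
qed

theorem theorem10p5:
  fixes pcirc :: "'a \<Rightarrow> 'a \<Rightarrow> 'a option"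
    and pbullet :: "'b \<Rightarrow> 'b \<Rightarrow> 'b option"
    and circ bullet :: "'q::complete_lattice \<Rightarrow> 'q \<Rightarrow> 'q"
  assumes "partial_semigroup pcirc"
    and "partial_semigroup pbullet"
    and "bi_quantale circ bullet"
  shows
    "bi_quantale
        (conv_circ pcirc circ :: ('a \<Rightarrow> 'b \<Rightarrow> 'q) \<Rightarrow> ('a \<Rightarrow> 'b \<Rightarrow> 'q) \<Rightarrow> ('a \<Rightarrow> 'b \<Rightarrow> 'q))
        (conv_bullet pbullet bullet) \<and>
     (distributive_bi_quantale circ bullet \<longrightarrow>
       distributive_bi_quantale
        (conv_circ pcirc circ :: ('a \<Rightarrow> 'b \<Rightarrow> 'q) \<Rightarrow> ('a \<Rightarrow> 'b \<Rightarrow> 'q) \<Rightarrow> ('a \<Rightarrow> 'b \<Rightarrow> 'q))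
        (conv_bullet pbullet bullet)) \<and>
     (\<forall>e1 e2 one_circ one_bullet.
       partial_monoid pcirc e1 \<and> partial_monoid pbullet e2 \<and>
       unital_bi_quantale circ bullet one_circ one_bullet \<longrightarrow>
       unital_bi_quantale
        (conv_circ pcirc circ :: ('a \<Rightarrow> 'b \<Rightarrow> 'q) \<Rightarrow> ('a \<Rightarrow> 'b \<Rightarrow> 'q) \<Rightarrow> ('a \<Rightarrow> 'b \<Rightarrow> 'q))
        (conv_bullet pbullet bullet)
        (unit_circ e1 one_circ) (unit_bullet e2 one_bullet)) \<and>
     (commutative_op pcirc \<and> commutative_op circ \<longrightarrow>
       commutative_op
        (conv_circ pcirc circ :: ('a \<Rightarrow> 'b \<Rightarrow> 'q) \<Rightarrow> ('a \<Rightarrow> 'b \<Rightarrow> 'q) \<Rightarrow> ('a \<Rightarrow> 'b \<Rightarrow> 'q))) \<and>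
     (commutative_op pbullet \<and> commutative_op bullet \<longrightarrow>
       commutative_op
        (conv_bullet pbullet bullet
          :: ('a \<Rightarrow> 'b \<Rightarrow> 'q) \<Rightarrow> ('a \<Rightarrow> 'b \<Rightarrow> 'q) \<Rightarrow> ('a \<Rightarrow> 'b \<Rightarrow> 'q)))"
proof (intro conjI impI allI)
  note convs = conv_circ_eq conv_bullet_eq
  interpret Q: bi_quantale circ bullet by fact
  have lift: "quantale (lift_op circ :: ('b \<Rightarrow> 'q) \<Rightarrow> _)"
    by (intro quantale_lift_op Q.circ.quantale_axioms)
  show bi: "bi_quantale
      (conv_circ pcirc circ :: ('a \<Rightarrow> 'b \<Rightarrow> 'q) \<Rightarrow> ('a \<Rightarrow> 'b \<Rightarrow> 'q) \<Rightarrow> ('a \<Rightarrow> 'b \<Rightarrow> 'q))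
      (conv_bullet pbullet bullet)"
    unfolding convs
    by (intro bi_quantale.intro quantale.quantale_conv lift assms
        quantale_lift_op Q.bullet.quantale_axioms)
  show "distributive_bi_quantale
      (conv_circ pcirc circ :: ('a \<Rightarrow> 'b \<Rightarrow> 'q) \<Rightarrow> ('a \<Rightarrow> 'b \<Rightarrow> 'q) \<Rightarrow> ('a \<Rightarrow> 'b \<Rightarrow> 'q))
      (conv_bullet pbullet bullet)" if "distributive_bi_quantale circ bullet"
  proof -
    interpret distributive_bi_quantale circ bullet by fact
    show ?thesis
      by (intro distributive_bi_quantale.intro distributive_bi_quantale_axioms.intro bi)
        \<comment> \<open>The two added laws concern only the lattice, whose operations are
          pointwise, so they are checked at each pair of arguments in \<open>Q\<close>.\<close>
        (simp_all add: fun_eq_iff inf_Sup_distrib sup_Inf_distrib image_image)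
  qed
  show "unital_bi_quantale
      (conv_circ pcirc circ :: ('a \<Rightarrow> 'b \<Rightarrow> 'q) \<Rightarrow> ('a \<Rightarrow> 'b \<Rightarrow> 'q) \<Rightarrow> ('a \<Rightarrow> 'b \<Rightarrow> 'q))
      (conv_bullet pbullet bullet) (unit_circ e1 one_circ) (unit_bullet e2 one_bullet)"
    if "partial_monoid pcirc e1 \<and> partial_monoid pbullet e2 \<and>
      unital_bi_quantale circ bullet one_circ one_bullet" for e1 e2 one_circ one_bullet
  proof -
    interpret U: unital_bi_quantale circ bullet one_circ one_bullet using that by blast
    show ?thesis
    proof (intro unital_bi_quantale.intro bi)
      \<comment> \<open>The value of this delta at \<open>e1\<close> is the constant function
        \<open>one_circ\<close>, the unit of \<open>lift_op circ\<close>.\<close>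
      show "monoid (conv_circ pcirc circ :: ('a \<Rightarrow> 'b \<Rightarrow> 'q) \<Rightarrow> _) (unit_circ e1 one_circ)"
        unfolding convs unit_circ_eq using that
        by (intro quantale.monoid_conv lift monoid_lift_op U.circ.monoid_axioms) blast
      show "monoid (conv_bullet pbullet bullet :: ('a \<Rightarrow> 'b \<Rightarrow> 'q) \<Rightarrow> _) (unit_bullet e2 one_bullet)"
        unfolding convs unit_bullet_eq using that
        by (intro monoid_lift_op Q.bullet.monoid_conv U.bullet.monoid_axioms) blast
    qed
  qed
\<comment> \<open>The two commutativity claims remain; both follow from preservation under
  \<open>conv\<close> and \<open>lift_op\<close>.\<close>
qed (simp_all add: conv_circ_eq conv_bullet_eq commutative_conv commutative_lift_op)

end
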